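(* Suppose that $\widetilde G=K_n$ (i.e. $\tilde g_{ij}=1$ for all $i\neq j$). Let $0=\lambda_1\le\lambda_2\le\dots\le\lambda_n$ be the eigenvalues of the Laplacian $L$ of $G$, with corresponding orthogonal eigenvectors $\mathbf q_1=\mathbf 1_n,\mathbf q_2,\dots,\mathbf q_n$, and define $m_j^*\equiv\mathbf q_j'\mathbf x$. Then the optimal public signal $\varphi^*$ informs the agents of a subset of $\{m_1^*,\dots,m_n^*\}$ (i.e. it consists, up to informational equivalence, of the disclosure of a subset of these statistics), and its elements are determined as follows: for $j=2,\dots,n$, $$m_j^*\in\mathcal I(\varphi^* )\iff \beta^{-1}\ge 2(n-\lambda_j).$$
   Context: Model. There are one principal and $n$ agents. Agent $i$ chooses $a_i\in\mathbb R$; $\mathbf a=(a_1,\dots,a_n)'$. The state $\mathbf x=(x_1,\dots,x_n)'$ is distributed as $N(\mu\mathbf 1_n,\sigma^2 I_n)$, with $\mu\in\mathbb R$, $\sigma^2>0$, $\mathbf 1_n$ the vector of ones. The incentive graph $G=[g_{ij}]$ and the synergy graph $\widetilde G=[\tilde g_{ij}]$ are symmetric $n\times n$ matrices with entries in $\{0,1\}$ and zero diagonal; $\beta\ge0$ is a parameter (with $\beta^{-1}=+\infty$ when $\beta=0$). Agent $i$'s payoff is $u_i(\mathbf a,\mathbf x)=-(a_i-x_i)^2-\beta\sum_{j} g_{ij}(a_i-a_j)^2$; the principal's payoff is $v(\mathbf a,\mathbf x)=-\sum_i (a_i-x_i)^2-\beta\sum_i\sum_j\tilde g_{ij}(a_i-a_j)^2$.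 A public signal is a map (Markov kernel) $\varphi:\mathbb R^n\to\Delta(M)$, $M$ a measurable space. All agents observe the realization $m$ and nothing else, form $\hat{\mathbf x}=\mathbb E[\mathbf x\mid m]$, and play the unique Nash equilibrium $\mathbf a^*=B\hat{\mathbf x}$, $B=(I_n+\beta L)^{-1}$, where $L=D_G-G$ and $\widetilde L=D_{\widetilde G}-\widetilde G$ are the graph Laplacians ($D$ the diagonal degree matrix). Then $\mathbb E[v(\mathbf a^*,\mathbf x)]=-\mathbb E[\mathbf x'\mathbf x]+\mathbb E[\hat{\mathbf x}'V\hat{\mathbf x}]$ with $V=B'(I_n-2\beta(\widetilde L-L))B$. A signal is optimal if it maximizes $\mathbb E[v(\mathbf a^*,\mathbf x)]$ (equivalently $\mathbb E[\hat{\mathbf x}'V\hat{\mathbf x}]$) over all public signals. By a known theorem, if $\mathbf z_1,\dots,\mathbf z_n$ is an orthonormal eigenbasis of the symmetric matrix $V$ with eigenvalues $\omega_1,\dots,\omega_n$, then the signal disclosing exactly the statistics $\mathbf z_j'\mathbf x$ for all $j$ with $\omega_j\ge0$ is optimal; "the optimal public signal" $\varphi^*$ denotes this signal. A signal $\varphi$ informs the agents of a random variable $y$, written $y\in\mathcal I(\varphi)$, if $\mathbb E[y\mid m]=y$ (almost surely). *)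

theory Defs
  imports "HOL-Probability.Probability"
begin

definition simple_graph_matrix :: "real^'n^'n \<Rightarrow> bool" where
  "simple_graph_matrix G \<longleftrightarrow>
     (\<forall>i j. G $ i $ j \<in> {0, 1}) \<and> transpose G = G \<and> (\<forall>i. G $ i $ i = 0)"

definition degree_matrix :: "real^'n^'n \<Rightarrow> real^'n^'n" where
  "degree_matrix G = (\<chi> i j. if i = j then (\<Sum>k\<in>UNIV. G $ i $ k) else 0)"

definition laplacian :: "real^'n^'n \<Rightarrow> real^'n^'n" where
  "laplacian G = degree_matrix G - G"

text \<open>The unique Nash equilibrium of the agents is \<open>equilibrium_matrix \<beta> G *v xhat\<close>, where
  \<open>xhat\<close> is the common posterior mean of the state. Up to a constant that does not depend on the
  signal, the principal's expected payoff is the expectation of the quadratic form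
  \<open>payoff_matrix \<beta> G Gt\<close> at \<open>xhat\<close>; here \<open>G\<close> is the incentive graph and \<open>Gt\<close> the synergy graph.\<close>

definition equilibrium_matrix :: "real \<Rightarrow> real^'n^'n \<Rightarrow> real^'n^'n" where
  "equilibrium_matrix \<beta> G = matrix_inv (mat 1 + \<beta> *\<^sub>R laplacian G)"

definition payoff_matrix :: "real \<Rightarrow> real^'n^'n \<Rightarrow> real^'n^'n \<Rightarrow> real^'n^'n" where
  "payoff_matrix \<beta> G Gt =
     transpose (equilibrium_matrix \<beta> G)
       ** (mat 1 - (2 * \<beta>) *\<^sub>R (laplacian Gt - laplacian G))
       ** equilibrium_matrix \<beta> G"

text \<open>Bases are indexed by \<open>{1..CARD('n)}\<close>, so that the eigenvalues can be listed in order.\<close>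

definition orthogonal_eigenbasis ::
  "real^'n^'n \<Rightarrow> (nat \<Rightarrow> real) \<Rightarrow> (nat \<Rightarrow> real^'n) \<Rightarrow> bool" where
  "orthogonal_eigenbasis A e v \<longleftrightarrow>
     (\<forall>j\<in>{1..CARD('n)}. v j \<noteq> 0 \<and> A *v v j = e j *\<^sub>R v j) \<and>
     pairwise (\<lambda>i j. orthogonal (v i) (v j)) {1..CARD('n)}"

definition orthonormal_eigenbasis ::
  "real^'n^'n \<Rightarrow> (nat \<Rightarrow> real) \<Rightarrow> (nat \<Rightarrow> real^'n) \<Rightarrow> bool" where
  "orthonormal_eigenbasis A e v \<longleftrightarrow>
     orthogonal_eigenbasis A e v \<and> (\<forall>j\<in>{1..CARD('n)}. norm (v j) = 1)"

text \<open>The law \<open>N(\<mu> 1, \<sigma>\<^sup>2 I)\<close> of the state; \<open>\<sigma>\<close> is the standard deviation.\<close>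

definition state_law :: "real \<Rightarrow> real \<Rightarrow> (real^'n) measure" where
  "state_law \<mu> \<sigma> = density lborel (\<lambda>x. ennreal (\<Prod>i\<in>UNIV. normal_density \<mu> \<sigma> (x $ i)))"

text \<open>A public signal with message space \<open>M\<close> is a Markov kernel
  \<open>\<phi> \<in> borel \<rightarrow>\<^sub>M prob_algebra M\<close>.\<close>

definition joint_law ::
  "(real^'n) measure \<Rightarrow> 'm measure \<Rightarrow> (real^'n \<Rightarrow> 'm measure) \<Rightarrow> ((real^'n) \<times> 'm) measure" where
  "joint_law P M \<phi> = P \<bind> (\<lambda>x. \<phi> x \<bind> (\<lambda>m. return (borel \<Otimes>\<^sub>M M) (x, m)))"

text \<open>The random variables \<open>y\<close>, as functions of the state, of which the signal informs the agents:
  \<open>E[y | m] = y\<close> almost surely. The integrability requirement is needed because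
  \<^const>\<open>real_cond_exp\<close> is a total function.\<close>

definition informed_variables ::
  "(real^'n) measure \<Rightarrow> 'm measure \<Rightarrow> (real^'n \<Rightarrow> 'm measure) \<Rightarrow> (real^'n \<Rightarrow> real) set" where
  "informed_variables P M \<phi> =
     {y. integrable (joint_law P M \<phi>) (\<lambda>p. y (fst p)) \<and>
         (AE p in joint_law P M \<phi>.
            real_cond_exp (joint_law P M \<phi>) (vimage_algebra (UNIV \<times> space M) snd M)
              (\<lambda>p. y (fst p)) p = y (fst p))}"

text \<open>Informational equivalence in the sense of Blackwell: each of the two signals can be
  generated from the other by a kernel that does not observe the state.\<close>

definition garbling_of ::
  "(real^'n) measure \<Rightarrow> 'k measure \<Rightarrow> (real^'n \<Rightarrow> 'k measure)
     \<Rightarrow> 'm measure \<Rightarrow> (real^'n \<Rightarrow> 'm measure) \<Rightarrow> bool" where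
  "garbling_of P N \<psi> M \<phi> \<longleftrightarrow> (\<exists>\<kappa> \<in> M \<rightarrow>\<^sub>M prob_algebra N. AE x in P. \<psi> x = \<phi> x \<bind> \<kappa>)"

definition informationally_equivalent ::
  "(real^'n) measure \<Rightarrow> 'k measure \<Rightarrow> (real^'n \<Rightarrow> 'k measure)
     \<Rightarrow> 'm measure \<Rightarrow> (real^'n \<Rightarrow> 'm measure) \<Rightarrow> bool" where
  "informationally_equivalent P N \<psi> M \<phi> \<longleftrightarrow> garbling_of P N \<psi> M \<phi> \<and> garbling_of P M \<phi> N \<psi>"

text \<open>The signal that discloses exactly the statistics \<open>v j \<bullet> x\<close> with \<open>j \<in> S\<close>. The optimal
  public signal is the one obtained from an orthonormal eigenbasis \<open>v\<close> of the payoff matrix, with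
  \<open>S\<close> the set of the indices of the nonnegative eigenvalues.\<close>

definition disclosure_space :: "nat set \<Rightarrow> (nat \<Rightarrow> real) measure" where
  "disclosure_space S = Pi\<^sub>M S (\<lambda>_. borel)"

definition disclose :: "(nat \<Rightarrow> real^'n) \<Rightarrow> nat set \<Rightarrow> real^'n \<Rightarrow> (nat \<Rightarrow> real) measure" where
  "disclose v S x = return (disclosure_space S) (\<lambda>j\<in>S. v j \<bullet> x)"

lemma disclose_kernel: "disclose v S \<in> borel \<rightarrow>\<^sub>M prob_algebra (disclosure_space S)"
  unfolding disclose_def disclosure_space_def
  by (rule measurable_compose[OF _ measurable_return_prob_space]) measurable

end

theory Submission
  imports Defs
begin

text \<open>Since the Laplacian of the complete graph is \<open>n I - 1 1'\<close>, every \<open>q j\<close> is also an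
  eigenvector of the payoff matrix; for \<open>j \<ge> 2\<close> its eigenvalue is
  \<open>(1 - 2 \<beta> (n - \<lambda>\<^sub>j)) / (1 + \<beta> \<lambda>\<^sub>j)\<^sup>2\<close>, and for \<open>j = 1\<close> it is \<open>1\<close>. Two eigenbases
  of one matrix span the same sum of eigenspaces with nonnegative eigenvalue, so the statistics
  \<open>z j \<bullet> x\<close> and \<open>q j \<bullet> x\<close> belonging to nonnegative eigenvalues are linear functions of each
  other. It remains to see that a linear statistic \<open>c \<bullet> x\<close> is known to the agents only if \<open>c\<close>
  lies in the span of the disclosed directions, which needs of the law of the state only that it is
  equivalent to Lebesgue measure and has a first moment.\<close>

section \<open>Eigenbases\<close>

lemma orthogonal_eigenbasisD:
  fixes A :: "real^'n^'n"
  assumes "orthogonal_eigenbasis A e v" and "j \<in> {1..CARD('n)}"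
  shows "v j \<noteq> 0" and "A *v v j = e j *\<^sub>R v j"
    and "k \<in> {1..CARD('n)} \<Longrightarrow> k \<noteq> j \<Longrightarrow> v k \<bullet> v j = 0"
  using assms unfolding orthogonal_eigenbasis_def pairwise_def orthogonal_def by auto

text \<open>Nonzero pairwise orthogonal vectors are independent, and there are as many of them as
  the dimension.\<close>

lemma span_orthogonal_eigenbasis:
  fixes A :: "real^'n^'n"
  assumes "orthogonal_eigenbasis A e v"
  shows "span (v ` {1..CARD('n)}) = UNIV"
proof -
  note D = orthogonal_eigenbasisD[OF assms]
  have "inj_on v {1..CARD('n)}"
    by (rule inj_onI) (metis D(1,3) inner_eq_zero_iff)
  then have card: "card (v ` {1..CARD('n)}) = CARD('n)"
    by (simp add: card_image)
  have "independent (v ` {1..CARD('n)})"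
  proof (rule pairwise_orthogonal_independent)
    show "pairwise orthogonal (v ` {1..CARD('n)})"
      unfolding pairwise_image by (simp add: pairwise_def orthogonal_def D(3))
  qed (use D(1) in auto)
  then have "dim (v ` {1..CARD('n)}) = DIM(real^'n)"
    using card by (simp add: dim_eq_card_independent)
  then show ?thesis
    using dim_eq_full by blast
qed

lemma orthogonal_eigenbasis_eq_0:
  fixes A :: "real^'n^'n"
  assumes "orthogonal_eigenbasis A e v" and "\<And>j. j \<in> {1..CARD('n)} \<Longrightarrow> v j \<bullet> x = 0"
  shows "x = 0"
proof -
  have "x \<in> span (v ` {1..CARD('n)})"
    unfolding span_orthogonal_eigenbasis[OF assms(1)] by simp
  then have "orthogonal x x"
    by (rule orthogonal_to_span) (use assms(2) in \<open>auto simp: orthogonal_def inner_commute\<close>)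
  then show ?thesis
    by (simp add: orthogonal_self)
qed

text \<open>An orthogonal eigenbasis makes \<open>A\<close> self-adjoint, so \<open>A\<close> can be
  moved onto \<open>v j\<close>. Both sides are linear in \<open>u\<close>, so checking basis
  vectors suffices.\<close>

lemma inner_orthogonal_eigenbasis:
  fixes A :: "real^'n^'n"
  assumes v: "orthogonal_eigenbasis A e v" and j: "j \<in> {1..CARD('n)}"
  shows "v j \<bullet> (A *v u) = e j * (v j \<bullet> u)"
proof -
  have "u \<in> span (v ` {1..CARD('n)})"
    unfolding span_orthogonal_eigenbasis[OF v] by simp
  then show ?thesis
  proof (induction rule: span_induct_alt)
    case (step c x y)
    then obtain k where k: "k \<in> {1..CARD('n)}" "x = v k" by auto
    have "v j \<bullet> (A *v x) = e j * (v j \<bullet> x)"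
      using orthogonal_eigenbasisD[OF v] j k by (cases "j = k") auto
    with step.IH show ?case
      by (simp add: matrix_vector_right_distrib matrix_vector_mult_scaleR inner_right_distrib
          distrib_left)
  qed simp
qed

lemma eigenvector_orthogonal_eigenbasis:
  fixes A :: "real^'n^'n"
  assumes "orthogonal_eigenbasis A e v" and "j \<in> {1..CARD('n)}"
    and "A *v u = c *\<^sub>R u" and "e j \<noteq> c"
  shows "v j \<bullet> u = 0"
  using inner_orthogonal_eigenbasis[OF assms(1,2), of u] assms(3,4) by simp

text \<open>The part \<open>d\<close> of \<open>u\<close> orthogonal to the span is orthogonal to
  every basis vector: by construction where \<open>e j = c\<close>, and elsewhere because both
  \<open>u\<close> and \<open>y\<close> are. Hence \<open>d = 0\<close>.\<close>

lemma eigenvector_in_eigenspan: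
  fixes A :: "real^'n^'n"
  assumes v: "orthogonal_eigenbasis A e v" and u: "A *v u = c *\<^sub>R u"
  shows "u \<in> span (v ` {j \<in> {1..CARD('n)}. e j = c})"
proof -
  let ?J = "{j \<in> {1..CARD('n)}. e j = c}"
  obtain y d where y: "y \<in> span (v ` ?J)"
    and d: "\<And>w. w \<in> span (v ` ?J) \<Longrightarrow> orthogonal d w" and u_eq: "u = y + d"
    using orthogonal_subspace_decomp_exists[of "v ` ?J" u] by auto
  have "v j \<bullet> d = 0" if j: "j \<in> {1..CARD('n)}" for j
  proof (cases "j \<in> ?J")
    case True
    then show ?thesis
      using d[OF span_base, of "v j"] by (simp add: orthogonal_def inner_commute)
  next
    case False
    have "orthogonal (v j) y"
      using False j orthogonal_eigenbasisD(3)[OF v]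
      by (intro orthogonal_to_span[OF y]) (auto simp: orthogonal_def)
    moreover have "v j \<bullet> u = 0"
      using eigenvector_orthogonal_eigenbasis[OF v j u] False j by simp
    ultimately show ?thesis
      by (simp add: u_eq orthogonal_def inner_right_distrib)
  qed
  then have "d = 0"
    by (rule orthogonal_eigenbasis_eq_0[OF v])
  with y show ?thesis
    by (simp add: u_eq)
qed

text \<open>Compares two eigenbases, with nonnegativity as \<open>Q\<close>. Repeated eigenvalues
  prevent matching vectors one by one, so spans are compared instead. If \<open>Q c\<close> fails,
  \<open>u\<close> is orthogonal to all spanning vectors, hence to itself.\<close>

lemma eigenvector_in_span_iff:
  fixes A :: "real^'n^'n"
  assumes v: "orthogonal_eigenbasis A e v" and u: "A *v u = c *\<^sub>R u" "u \<noteq> 0"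
  shows "u \<in> span (v ` {j \<in> {1..CARD('n)}. Q (e j)}) \<longleftrightarrow> Q c"
proof
  assume "Q c"
  then have "v ` {j \<in> {1..CARD('n)}. e j = c} \<subseteq> v ` {j \<in> {1..CARD('n)}. Q (e j)}"
    by auto
  with eigenvector_in_eigenspan[OF v u(1)]
  show "u \<in> span (v ` {j \<in> {1..CARD('n)}. Q (e j)})"
    using span_mono by blast
next
  assume u_in: "u \<in> span (v ` {j \<in> {1..CARD('n)}. Q (e j)})"
  show "Q c"
  proof (rule ccontr)
    assume "\<not> Q c"
    have "orthogonal u u"
    proof (rule orthogonal_to_span[OF u_in])
      fix w assume "w \<in> v ` {j \<in> {1..CARD('n)}. Q (e j)}"
      then obtain j where "j \<in> {1..CARD('n)}" "e j \<noteq> c" "w = v j"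
        using \<open>\<not> Q c\<close> by auto
      then show "orthogonal u w"
        using eigenvector_orthogonal_eigenbasis[OF v _ u(1)]
        by (simp add: orthogonal_def inner_commute)
    qed
    with u(2) show False
      by (simp add: orthogonal_self)
  qed
qed

section \<open>Spectrum of the payoff matrix\<close>

lemma laplacian_mult_component:
  "(laplacian G *v x) $ i = (\<Sum>k\<in>UNIV. G $ i $ k * (x $ i - x $ k))"
proof -
  have "(\<Sum>k\<in>UNIV. (if i = k then d else 0) * x $ k) = d * x $ i" for d
    by (simp add: if_distrib[of "\<lambda>r. r * _"] cong: if_cong)
  then show ?thesis
    by (simp add: laplacian_def degree_matrix_def matrix_vector_mult_def left_diff_distrib
        right_diff_distrib sum_subtractf sum_distrib_right)
qed

lemma transpose_laplacian:
  assumes "transpose G = G"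
  shows "transpose (laplacian G) = laplacian G"
proof -
  have "G $ i $ j = G $ j $ i" for i j
    using arg_cong[OF assms, of "\<lambda>A. A $ i $ j"] by (simp add: transpose_def)
  then show ?thesis
    by (auto simp: laplacian_def degree_matrix_def transpose_def vec_eq_iff)
qed

lemma laplacian_complete_graph:
  fixes Gt :: "real^'n^'n"
  assumes "\<And>i j. i \<noteq> j \<Longrightarrow> Gt $ i $ j = 1"
  shows "laplacian Gt *v x = real CARD('n) *\<^sub>R x - (\<chi> i. \<Sum>k\<in>UNIV. x $ k)"
proof -
  have "(laplacian Gt *v x) $ i = (\<Sum>k\<in>UNIV. x $ i - x $ k)" for i
    unfolding laplacian_mult_component
  proof (rule sum.cong[OF refl])
    show "Gt $ i $ k * (x $ i - x $ k) = x $ i - x $ k" for k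
      using assms[of i k] by (cases "i = k") auto
  qed
  then show ?thesis
    by (simp add: vec_eq_iff sum_subtractf)
qed

text \<open>Applying \<open>A\<close> to the eigenvalue equation of \<open>N\<close> leaves
  \<open>u\<close> alone on one side. Used for the inverse and for its transpose.\<close>

lemma left_inverse_eigenvector:
  fixes A N :: "real^'n^'n"
  assumes "A ** N = mat 1" and "N *v u = c *\<^sub>R u" and "c \<noteq> 0"
  shows "A *v u = inverse c *\<^sub>R u"
proof -
  have "c *\<^sub>R (A *v u) = u"
    using assms(1,2) by (metis matrix_vector_mul_assoc matrix_vector_mul_lid matrix_vector_mult_scaleR)
  then have "inverse c *\<^sub>R (c *\<^sub>R (A *v u)) = inverse c *\<^sub>R u"
    by simp
  with \<open>c \<noteq> 0\<close> show ?thesis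
    by simp
qed

text \<open>\<open>q j\<close> is an eigenvector of every factor: with eigenvalue
  \<open>1 / (1 + \<beta> * lam j)\<close> for the equilibrium matrix and its transpose, and
  \<open>1 - 2 * \<beta> * (c - lam j)\<close> for the middle factor.\<close>

lemma payoff_matrix_eigenvector:
  fixes G Gt :: "real^'n^'n"
  assumes G: "transpose G = G" and q: "orthogonal_eigenbasis (laplacian G) lam q"
    and pos: "\<And>j. j \<in> {1..CARD('n)} \<Longrightarrow> 1 + \<beta> * lam j > 0"
    and j: "j \<in> {1..CARD('n)}" and Gt: "laplacian Gt *v q j = c *\<^sub>R q j"
  shows "payoff_matrix \<beta> G Gt *v q j = ((1 - 2 * \<beta> * (c - lam j)) / (1 + \<beta> * lam j)\<^sup>2) *\<^sub>R q j"
proof -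
  define N where "N = mat 1 + \<beta> *\<^sub>R laplacian G"
  have N_mult: "N *v x = x + \<beta> *\<^sub>R (laplacian G *v x)" for x
    by (simp add: N_def matrix_vector_mult_add_rdistrib scaleR_matrix_vector_assoc)
  \<comment> \<open>The kernel is trivial because \<open>N\<close> multiplies the coordinate along
    each \<open>q k\<close> by a positive number.\<close>
  have "x = 0" if "N *v x = 0" for x
  proof -
    have "q k \<bullet> x = 0" if k: "k \<in> {1..CARD('n)}" for k
    proof -
      have "(1 + \<beta> * lam k) * (q k \<bullet> x) = q k \<bullet> (N *v x)"
        by (simp add: N_mult inner_right_distrib inner_orthogonal_eigenbasis[OF q k] algebra_simps)
      with \<open>N *v x = 0\<close> pos[OF k] show ?thesis
        by simp
    qed
    then show ?thesis
      by (rule orthogonal_eigenbasis_eq_0[OF q])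
  qed
  then have inv: "invertible N"
    unfolding invertible_left_inverse matrix_left_invertible_ker by blast
  let ?B = "matrix_inv N" and ?s = "inverse (1 + \<beta> * lam j)"
  have N_q: "N *v q j = (1 + \<beta> * lam j) *\<^sub>R q j"
    by (simp add: N_mult orthogonal_eigenbasisD(2)[OF q j] scaleR_left_distrib)
  \<comment> \<open>\<open>matrix_inv\<close> is defined by choice; invertibility makes the chosen
    matrix a two-sided inverse.\<close>
  have B: "?B ** N = mat 1 \<and> N ** ?B = mat 1"
    using inv unfolding invertible_def matrix_inv_def by (rule someI2_ex) simp
  then have B_q: "?B *v q j = ?s *\<^sub>R q j"
    using left_inverse_eigenvector[OF _ N_q] pos[OF j] by simp
  \<comment> \<open>As \<open>N\<close> is symmetric, transposing \<open>N ** ?B = mat 1\<close>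
    shows that the transpose of \<open>?B\<close> is a left inverse of \<open>N\<close> too.\<close>
  have "transpose (N ** ?B) = mat 1"
    using B by (simp add: transpose_mat)
  moreover have "transpose N = N"
    using transpose_laplacian[OF G]
    by (simp add: N_def transpose_def mat_def vec_eq_iff)
  ultimately have "transpose ?B ** N = mat 1"
    by (simp add: matrix_transpose_mul)
  then have BT_q: "transpose ?B *v q j = ?s *\<^sub>R q j"
    by (rule left_inverse_eigenvector[OF _ N_q]) (use pos[OF j] in simp)
  have "payoff_matrix \<beta> G Gt *v q j =
    transpose ?B *v ((mat 1 - (2 * \<beta>) *\<^sub>R (laplacian Gt - laplacian G)) *v (?B *v q j))"
    by (simp add: payoff_matrix_def equilibrium_matrix_def N_def matrix_vector_mul_assoc
        matrix_mul_assoc)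
  also have "(mat 1 - (2 * \<beta>) *\<^sub>R (laplacian Gt - laplacian G)) *v (?B *v q j) =
    (?s * (1 - 2 * \<beta> * (c - lam j))) *\<^sub>R q j"
    by (simp add: B_q matrix_vector_mult_scaleR matrix_vector_mult_diff_rdistrib
        scaleR_matrix_vector_assoc[symmetric] Gt orthogonal_eigenbasisD(2)[OF q j] algebra_simps)
  finally show ?thesis
    unfolding matrix_vector_mult_scaleR BT_q by (simp add: divide_simps power2_eq_square)
qed

section \<open>The Gaussian law of the state\<close>

text \<open>The product formula for Lebesgue measure runs over \<open>Basis\<close>; reindexing by
  \<open>axis i 1\<close> turns it into one over coordinates.\<close>

lemma nn_integral_lborel_vec_prod:
  fixes f :: "'n::finite \<Rightarrow> real \<Rightarrow> ennreal"
  assumes [measurable]: "\<And>i. f i \<in> borel_measurable borel"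
  shows "(\<integral>\<^sup>+x. (\<Prod>i\<in>UNIV. f i (x $ i)) \<partial>(lborel :: (real^'n) measure)) =
    (\<Prod>i\<in>UNIV. \<integral>\<^sup>+t. f i t \<partial>lborel)"
proof -
  let ?a = "\<lambda>i::'n. axis i (1::real)"
  have inj: "inj ?a"
    by (auto simp: inj_def axis_eq_axis)
  have Basis: "Basis = range ?a"
    by (auto simp: Basis_vec_def)
  have "(\<integral>\<^sup>+x. (\<Prod>b\<in>Basis. f (inv ?a b) (x \<bullet> b)) \<partial>(lborel :: (real^'n) measure)) =
    (\<Prod>b\<in>Basis. \<integral>\<^sup>+t. f (inv ?a b) t \<partial>lborel)"
    by (rule nn_integral_lborel_prod) auto
  then show ?thesis
    by (simp add: Basis prod.reindex[OF inj] inv_f_f[OF inj] inner_axis)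
qed

lemma sets_state_law [measurable_cong, simp]: "sets (state_law \<mu> \<sigma>) = sets borel"
  and space_state_law [simp]: "space (state_law \<mu> \<sigma>) = UNIV"
  by (simp_all add: state_law_def)

context
  fixes \<mu> \<sigma> :: real
  assumes sigma: "\<sigma> > 0"
begin

lemma prob_space_state_law: "prob_space (state_law \<mu> \<sigma> :: (real^'n) measure)"
proof
  have "emeasure (state_law \<mu> \<sigma> :: (real^'n) measure) UNIV =
    (\<integral>\<^sup>+x. (\<Prod>i\<in>UNIV. ennreal (normal_density \<mu> \<sigma> (x $ i))) \<partial>(lborel :: (real^'n) measure))"
    by (simp add: state_law_def emeasure_density prod_ennreal)
  also have "\<dots> = 1"
    using sigma by (subst nn_integral_lborel_vec_prod) (simp_all add: nn_integral_eq_integral)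
  finally show "emeasure (state_law \<mu> \<sigma> :: (real^'n) measure)
      (space (state_law \<mu> \<sigma>)) = 1"
    by simp
qed

text \<open>The density is strictly positive. This gives access to the translation invariance of
  Lebesgue measure.\<close>

lemma AE_state_law_iff:
  "(AE x in state_law \<mu> \<sigma>. Q x) \<longleftrightarrow> (AE x :: real^'n in lborel. Q x)"
  unfolding state_law_def using sigma
  by (subst AE_density) (auto simp: prod_pos normal_density_pos ennreal_less_zero_iff)

lemma integrable_state_law_component:
  "integrable (state_law \<mu> \<sigma>) (\<lambda>x :: real^'n. x $ i)"
proof (rule integrableI_bounded)
  \<comment> \<open>Absorbing the absolute value into the factor of coordinate \<open>i\<close>
    keeps the integrand a product; every other factor integrates to 1.\<close>
  let ?f = "\<lambda>k t. ennreal (normal_density \<mu> \<sigma> t) * (if k = i then ennreal \<bar>t\<bar> else 1)"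
  have "integrable lborel (\<lambda>t. normal_density \<mu> \<sigma> t * t)"
    using sigma by (rule integrable_normal_moment_nz_1)
  from integrable_norm[OF this]
  have fin: "(\<integral>\<^sup>+t. ennreal (normal_density \<mu> \<sigma> t) * ennreal \<bar>t\<bar> \<partial>lborel) < \<infinity>"
    unfolding integrable_iff_bounded by (simp add: abs_mult ennreal_mult)
  have "(\<integral>\<^sup>+x. norm (x $ i) \<partial>state_law \<mu> \<sigma>) =
    (\<integral>\<^sup>+x. (\<Prod>k\<in>UNIV. ?f k (x $ k)) \<partial>(lborel :: (real^'n) measure))"
    by (simp add: state_law_def nn_integral_density prod_ennreal prod.distrib)
  also have "\<dots> = (\<Prod>k\<in>UNIV. \<integral>\<^sup>+t. ?f k t \<partial>lborel)"
    by (rule nn_integral_lborel_vec_prod) simp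
  also have "\<dots> = (\<Prod>k\<in>UNIV. if k = i
      then \<integral>\<^sup>+t. ennreal (normal_density \<mu> \<sigma> t) * ennreal \<bar>t\<bar> \<partial>lborel else 1)"
    using sigma by (intro prod.cong) (simp_all add: nn_integral_eq_integral)
  also have "\<dots> < \<infinity>"
    using fin by simp
  finally show "(\<integral>\<^sup>+x. norm (x $ i) \<partial>(state_law \<mu> \<sigma> :: (real^'n) measure)) < \<infinity>" .
qed measurable

lemma integrable_state_law_inner:
  "integrable (state_law \<mu> \<sigma>) (\<lambda>x :: real^'n. c \<bullet> x)"
  unfolding inner_vec_def inner_real_def
  by (intro Bochner_Integration.integrable_sum integrable_mult_right integrable_state_law_component)

end

section \<open>Disclosure of linear statistics\<close>

text \<open>Coefficients are indexed by \<open>T\<close> itself, since messages are functions on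
  \<open>T\<close>.\<close>

lemma span_image_coefficients:
  fixes v :: "'i \<Rightarrow> 'a::real_vector"
  assumes "finite T" and "u \<in> span (v ` T)"
  obtains c where "u = (\<Sum>j\<in>T. c j *\<^sub>R v j)"
proof -
  from assms(2) have "\<exists>c. u = (\<Sum>j\<in>T. c j *\<^sub>R v j)"
  proof (induction rule: span_induct_alt)
    case base
    show ?case by (rule exI[of _ "\<lambda>_. 0"]) simp
  next
    case (step a x y)
    then obtain k c where k: "k \<in> T" "x = v k" and c: "y = (\<Sum>j\<in>T. c j *\<^sub>R v j)"
      by auto
    have "a *\<^sub>R x = (\<Sum>j\<in>T. (if j = k then a else 0) *\<^sub>R v j)"
      using k assms(1) by (simp add: if_distrib[of "\<lambda>r. r *\<^sub>R _"] sum.delta cong: if_cong)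
    then have "a *\<^sub>R x + y = (\<Sum>j\<in>T. ((if j = k then a else 0) + c j) *\<^sub>R v j)"
      by (simp add: c scaleR_left_distrib sum.distrib)
    then show ?case by (intro exI[of _ "\<lambda>j. (if j = k then a else 0) + c j"])
  qed
  with that show ?thesis by blast
qed

lemma measurable_statistics [measurable]:
  fixes v :: "nat \<Rightarrow> real^'n"
  shows "(\<lambda>x. \<lambda>j\<in>T. v j \<bullet> x) \<in> borel \<rightarrow>\<^sub>M disclosure_space T"
  unfolding disclosure_space_def by measurable

text \<open>Each \<open>u j\<close> is a fixed combination of the disclosed \<open>v k\<close>, so
  one message is a linear function of the other and the garbling is deterministic.\<close>

lemma garbling_of_disclose:
  fixes u v :: "nat \<Rightarrow> real^'n"
  assumes T: "finite T" and span: "\<And>j. j \<in> S \<Longrightarrow> u j \<in> span (v ` T)"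
  shows "garbling_of P (disclosure_space S) (disclose u S) (disclosure_space T) (disclose v T)"
proof -
  have "\<forall>j\<in>S. \<exists>a. u j = (\<Sum>k\<in>T. a k *\<^sub>R v k)"
    by (metis span_image_coefficients[OF T] span)
  then obtain c where c: "\<And>j. j \<in> S \<Longrightarrow> u j = (\<Sum>k\<in>T. c j k *\<^sub>R v k)"
    using bchoice by metis
  define \<kappa> where "\<kappa> = (\<lambda>m. return (disclosure_space S) (\<lambda>j\<in>S. \<Sum>k\<in>T. c j k * m k))"
  have "(\<lambda>m. \<lambda>j\<in>S. \<Sum>k\<in>T. c j k * m k) \<in> disclosure_space T \<rightarrow>\<^sub>M disclosure_space S"
    unfolding disclosure_space_def by measurable
  then have \<kappa>: "\<kappa> \<in> disclosure_space T \<rightarrow>\<^sub>M prob_algebra (disclosure_space S)"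
    unfolding \<kappa>_def by (rule measurable_compose[OF _ measurable_return_prob_space])
  have "disclose u S x = disclose v T x \<bind> \<kappa>" for x
  proof -
    have "disclose v T x \<bind> \<kappa> = \<kappa> (\<lambda>k\<in>T. v k \<bullet> x)"
      unfolding disclose_def
      by (rule bind_return[OF measurable_prob_algebraD[OF \<kappa>]])
         (simp add: disclosure_space_def space_PiM)
    also have "\<dots> = disclose u S x"
      unfolding \<kappa>_def disclose_def
      by (intro arg_cong[of _ _ "return _"] restrict_ext) (simp add: c inner_sum_left)
    finally show ?thesis by simp
  qed
  with \<kappa> show ?thesis
    unfolding garbling_of_def by auto
qed

text \<open>The message is a function of the state, so the joint law lives on its graph and
  almost-sure claims about pairs become claims about states.\<close>

lemma joint_law_disclose:
  fixes v :: "nat \<Rightarrow> real^'n"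
  assumes "sets P = sets borel"
  shows "joint_law P (disclosure_space T) (disclose v T) =
    distr P (borel \<Otimes>\<^sub>M disclosure_space T) (\<lambda>x. (x, \<lambda>j\<in>T. v j \<bullet> x))"
proof -
  note [measurable_cong] = assms
  have "disclose v T x \<bind> (\<lambda>m. return (borel \<Otimes>\<^sub>M disclosure_space T) (x, m)) =
    return (borel \<Otimes>\<^sub>M disclosure_space T) (x, \<lambda>j\<in>T. v j \<bullet> x)" for x
    unfolding disclose_def
    by (rule bind_return[where N = "borel \<Otimes>\<^sub>M disclosure_space T"])
       (measurable, simp add: disclosure_space_def space_PiM)
  then show ?thesis
    unfolding joint_law_def using sets_eq_imp_space_eq[OF assms]
    by (simp add: bind_return_distr')
qed

text \<open>If \<open>c\<close> has a component \<open>d \<noteq> 0\<close> orthogonal to the disclosed directions, then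
  translation by \<open>d\<close> preserves null sets and the message but changes \<open>c \<bullet> x\<close>, so \<open>c \<bullet> x\<close>
  cannot be a function of the message.\<close>

lemma inner_informed_disclose_iff:
  fixes v :: "nat \<Rightarrow> real^'n"
  assumes sigma: "\<sigma> > 0" and T: "finite T"
  shows "(\<lambda>x. c \<bullet> x) \<in> informed_variables (state_law \<mu> \<sigma>) (disclosure_space T) (disclose v T)
    \<longleftrightarrow> c \<in> span (v ` T)"
proof -
  let ?P = "state_law \<mu> \<sigma> :: (real^'n) measure" and ?M = "disclosure_space T"
  define g where "g = (\<lambda>x. \<lambda>j\<in>T. v j \<bullet> x)"
  define J where "J = joint_law ?P ?M (disclose v T)"
  define F where "F = vimage_algebra (UNIV \<times> space ?M) (snd :: (real^'n) \<times> _ \<Rightarrow> _) ?M"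
  define E where "E = real_cond_exp J F (\<lambda>p. c \<bullet> fst p)"
  have g_meas [measurable]: "g \<in> borel \<rightarrow>\<^sub>M ?M"
    unfolding g_def by measurable
  have J_eq: "J = distr ?P (borel \<Otimes>\<^sub>M ?M) (\<lambda>x. (x, g x))"
    unfolding J_def g_def by (rule joint_law_disclose) simp
  have sets_J [measurable_cong]: "sets J = sets (borel \<Otimes>\<^sub>M ?M)"
    and space_J: "space J = UNIV \<times> space ?M"
    by (simp_all add: J_eq space_pair_measure)
  have sets_F: "sets F = {snd -` A \<inter> (UNIV \<times> space ?M) | A. A \<in> sets ?M}"
    unfolding F_def by (rule sets_vimage_algebra2) auto
  have "subalgebra J F"
    unfolding subalgebra_def
  proof
    show "space F = space J"
      by (simp add: F_def space_J)
    have "snd -` A \<inter> (UNIV \<times> space ?M) \<in> sets J" if "A \<in> sets ?M" for A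
      using measurable_sets[OF measurable_snd that, of borel]
      by (simp add: sets_J space_pair_measure)
    then show "sets F \<subseteq> sets J"
      by (auto simp: sets_F)
  qed
  moreover have "prob_space J"
    unfolding J_eq by (rule prob_space.prob_space_distr[OF prob_space_state_law[OF sigma]]) measurable
  ultimately interpret finite_measure_subalgebra J F
    by (simp add: finite_measure_subalgebra_def finite_measure_subalgebra_axioms_def
        prob_space_def)
  have int: "integrable J (\<lambda>p. c \<bullet> fst p)"
    unfolding J_eq by (subst integrable_distr_eq) (auto simp: integrable_state_law_inner[OF sigma])
  have E_J [measurable]: "E \<in> borel_measurable (borel \<Otimes>\<^sub>M ?M)"
    using borel_measurable_cond_exp2[of J F] by (simp add: E_def measurable_cong_sets[OF sets_J refl])
  have informed_iff: "(\<lambda>x. c \<bullet> x) \<in> informed_variables ?P ?M (disclose v T)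
      \<longleftrightarrow> (AE p in J. E p = c \<bullet> fst p)"
    using int unfolding informed_variables_def J_def[symmetric] F_def[symmetric] E_def by simp
  show ?thesis
  proof
    assume "c \<in> span (v ` T)"
    then obtain a where a: "c = (\<Sum>j\<in>T. a j *\<^sub>R v j)"
      using span_image_coefficients[OF T] by blast
    \<comment> \<open>\<open>h\<close> rebuilds the statistic from the message alone; being
      \<open>F\<close>-measurable, it is its own conditional expectation.\<close>
    define h where "h = (\<lambda>p :: (real^'n) \<times> (nat \<Rightarrow> real). \<Sum>j\<in>T. a j * snd p j)"
    have [measurable]: "(\<lambda>m. \<Sum>j\<in>T. a j * m j) \<in> borel_measurable ?M"
      unfolding disclosure_space_def by measurable
    have h_F: "h \<in> borel_measurable F"
      unfolding h_def F_def
      by (rule measurable_compose[OF measurable_vimage_algebra1]) auto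
    have h_meas [measurable]: "h \<in> borel_measurable (borel \<Otimes>\<^sub>M ?M)"
      unfolding h_def by measurable
    have ae: "AE p in J. c \<bullet> fst p = h p"
      unfolding J_eq by (subst AE_distr_iff) (auto simp: a g_def h_def inner_sum_left)
    have int_h: "integrable J h"
      using int ae by (subst integrable_cong_AE[where g = "\<lambda>p. c \<bullet> fst p"]) auto
    have "AE p in J. E p = real_cond_exp J F h p"
      unfolding E_def by (rule real_cond_exp_cong[OF ae]) measurable
    with ae real_cond_exp_F_meas[OF int_h h_F] have "AE p in J. E p = c \<bullet> fst p"
      by auto
    with informed_iff show "(\<lambda>x. c \<bullet> x) \<in> informed_variables ?P ?M (disclose v T)" by simp
  next
    assume "(\<lambda>x. c \<bullet> x) \<in> informed_variables ?P ?M (disclose v T)"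
    with informed_iff have "AE p in J. E p = c \<bullet> fst p" by simp
    then have "AE x in ?P. E (x, g x) = c \<bullet> x"
      unfolding J_eq by (subst (asm) AE_distr_iff) auto
    then have ae: "AE x in lborel. E (x, g x) = c \<bullet> x"
      by (simp add: AE_state_law_iff[OF sigma])
    obtain y d where y: "y \<in> span (v ` T)"
      and d: "\<And>w. w \<in> span (v ` T) \<Longrightarrow> orthogonal d w" and c_eq: "c = y + d"
      using orthogonal_subspace_decomp_exists[of "v ` T" c] by auto
    have g_shift: "g (d + x) = g x" for x
      using d[OF span_base] unfolding g_def
      by (intro restrict_ext) (auto simp: inner_right_distrib orthogonal_def inner_commute[of _ d])
    \<comment> \<open>The level sets of the \<open>F\<close>-measurable \<open>E\<close> are
      preimages of message sets, so everywhere, not just almost surely, \<open>E\<close> depends on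
      the message only.\<close>
    have E_shift: "E (d + x, g x) = E (x, g x)" for x
    proof -
      have "E -` {E (x, g x)} \<inter> space F \<in> sets F"
        using borel_measurable_cond_exp[of J F] by (auto simp: E_def intro: measurable_sets)
      then obtain A where A: "E -` {E (x, g x)} \<inter> space F = snd -` A \<inter> (UNIV \<times> space ?M)"
        using sets_F by auto
      have "g x \<in> space ?M"
        using measurable_space[OF g_meas] by simp
      then have "(x, g x) \<in> space F" "(d + x, g x) \<in> UNIV \<times> space ?M"
        by (auto simp: F_def)
      moreover from this have "(x, g x) \<in> snd -` A \<inter> (UNIV \<times> space ?M)"
        unfolding A[symmetric] by simp
      ultimately have "(d + x, g x) \<in> E -` {E (x, g x)} \<inter> space F"
        unfolding A by simp
      then show ?thesis by simp
    qed
    \<comment> \<open>By translation invariance the identity also holds at \<open>d + x\<close> for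
      almost every \<open>x\<close>; subtracting the two leaves
      \<open>c \<bullet> d = 0\<close>.\<close>
    have "AE x in distr lborel borel ((+) d). E (x, g x) = c \<bullet> x"
      using ae unfolding lborel_distr_plus .
    then have "AE x in lborel. E (d + x, g (d + x)) = c \<bullet> (d + x)"
      by (rule AE_distrD[rotated]) simp
    with ae have "AE x in lborel :: (real^'n) measure. c \<bullet> d = 0"
      by eventually_elim (simp add: g_shift E_shift inner_right_distrib)
    then have "AE x in ?P. c \<bullet> d = 0"
      by (simp only: AE_state_law_iff[OF sigma])
    then have "c \<bullet> d = 0"
      using prob_space.AE_const[OF prob_space_state_law[OF sigma]] by blast
    moreover have "y \<bullet> d = 0"
      using d[OF y] by (simp add: orthogonal_def inner_commute)
    ultimately have "d = 0"
      by (simp add: c_eq inner_left_distrib)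
    with y show "c \<in> span (v ` T)"
      by (simp add: c_eq)
  qed
qed

section \<open>Comparison of the two eigenbases and the eigenvalue cutoff\<close>

theorem proposition6:
  fixes G Gt :: "real^'n^'n"
    and \<beta> \<mu> \<sigma> :: real
    and lam \<omega> :: "nat \<Rightarrow> real"
    and q z :: "nat \<Rightarrow> real^'n"
  assumes "simple_graph_matrix G" and "simple_graph_matrix Gt"
    and "\<And>i j. i \<noteq> j \<Longrightarrow> Gt $ i $ j = 1"
    and "\<beta> \<ge> 0" and "\<sigma> > 0"
    and "orthogonal_eigenbasis (laplacian G) lam q"
    and "lam 1 = 0" and "mono_on {1..CARD('n)} lam" and "q 1 = (\<chi> i. 1)"
    and "orthonormal_eigenbasis (payoff_matrix \<beta> G Gt) \<omega> z"
  defines "P \<equiv> state_law \<mu> \<sigma> :: (real^'n) measure"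
    and "T \<equiv> {j \<in> {1..CARD('n)}. \<omega> j \<ge> 0}"
  defines "M \<equiv> disclosure_space T"
    and "\<phi> \<equiv> disclose z T"
    and "m \<equiv> \<lambda>j (x :: real^'n). q j \<bullet> x"
  defines "S \<equiv> {j \<in> {1..CARD('n)}. m j \<in> informed_variables P M \<phi>}"
  shows "informationally_equivalent P M \<phi> (disclosure_space S) (disclose q S)
    \<and> (\<forall>j\<in>{2..CARD('n)}. m j \<in> informed_variables P M \<phi> \<longleftrightarrow>
          inverse (ereal \<beta>) \<ge> ereal (2 * (real CARD('n) - lam j)))"
proof -
  let ?n = "CARD('n)" and ?V = "payoff_matrix \<beta> G Gt"
  note q = \<open>orthogonal_eigenbasis (laplacian G) lam q\<close>
  have z: "orthogonal_eigenbasis ?V \<omega> z"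
    using \<open>orthonormal_eigenbasis ?V \<omega> z\<close> by (simp add: orthonormal_eigenbasis_def)
  have G: "transpose G = G"
    using \<open>simple_graph_matrix G\<close> by (simp add: simple_graph_matrix_def)
  have "lam j \<ge> 0" if "j \<in> {1..?n}" for j
    using mono_onD[OF \<open>mono_on {1..?n} lam\<close>, of 1 j] that \<open>lam 1 = 0\<close> by simp
  then have pos: "1 + \<beta> * lam j > 0" if "j \<in> {1..?n}" for j
    using that \<open>\<beta> \<ge> 0\<close> by (simp add: add_pos_nonneg)
  \<comment> \<open>The spectrum of the complete graph: 0 on the vector of ones,
    \<open>CARD('n)\<close> on its orthogonal complement, which contains the other
    \<open>q j\<close>.\<close>
  define c where "c j = (if j = 1 then 0 else real ?n)" for j :: nat
  have Gt: "laplacian Gt *v q j = c j *\<^sub>R q j" if j: "j \<in> {1..?n}" for j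
  proof (cases "j = 1")
    case True
    then show ?thesis
      using laplacian_complete_graph[of Gt "q 1"] assms(3) \<open>q 1 = (\<chi> i. 1)\<close>
      by (simp add: c_def vec_eq_iff)
  next
    case False
    then have "q 1 \<bullet> q j = 0"
      using orthogonal_eigenbasisD(3)[OF q j, of 1] by simp
    then have "(\<Sum>k\<in>UNIV. q j $ k) = 0"
      by (simp add: \<open>q 1 = (\<chi> i. 1)\<close> inner_vec_def del: One_nat_def)
    with False show ?thesis
      using laplacian_complete_graph[of Gt "q j"] assms(3) by (simp add: c_def vec_eq_iff)
  qed
  define \<nu> where "\<nu> j = (1 - 2 * \<beta> * (c j - lam j)) / (1 + \<beta> * lam j)\<^sup>2" for j
  have V_q: "?V *v q j = \<nu> j *\<^sub>R q j" if "j \<in> {1..?n}" for j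
    unfolding \<nu>_def by (rule payoff_matrix_eigenvector[OF G q pos that Gt[OF that]])
  then have qV: "orthogonal_eigenbasis ?V \<nu> q"
    using q by (simp add: orthogonal_eigenbasis_def)
  have T: "finite T"
    by (simp add: T_def)
  have informed_span: "m j \<in> informed_variables P M \<phi> \<longleftrightarrow> q j \<in> span (z ` T)" for j
    unfolding m_def P_def M_def \<phi>_def by (rule inner_informed_disclose_iff[OF \<open>\<sigma> > 0\<close> T])
  have informed: "m j \<in> informed_variables P M \<phi> \<longleftrightarrow> \<nu> j \<ge> 0" if j: "j \<in> {1..?n}" for j
    unfolding informed_span T_def
    using eigenvector_in_span_iff[OF z V_q[OF j] orthogonal_eigenbasisD(1)[OF q j],
        where Q = "\<lambda>e. e \<ge> 0"] .
  have S: "S = {j \<in> {1..?n}. \<nu> j \<ge> 0}"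
    unfolding S_def using informed by blast
  \<comment> \<open>The same criterion with the roles of \<open>z\<close> and \<open>q\<close>
    exchanged, which is possible because both are eigenbases of \<open>?V\<close>.\<close>
  have "z k \<in> span (q ` S)" if "k \<in> T" for k
    using that eigenvector_in_span_iff[OF qV orthogonal_eigenbasisD(2,1)[OF z, of k],
        where Q = "\<lambda>e. e \<ge> 0"]
    by (simp add: S T_def)
  moreover have "q j \<in> span (z ` T)" if "j \<in> S" for j
    using that informed_span by (simp add: S_def)
  ultimately have "informationally_equivalent P M \<phi> (disclosure_space S) (disclose q S)"
    unfolding informationally_equivalent_def M_def \<phi>_def using T
    by (auto intro!: garbling_of_disclose simp: S)
  moreover have "m j \<in> informed_variables P M \<phi> \<longleftrightarrow>
      inverse (ereal \<beta>) \<ge> ereal (2 * (real ?n - lam j))" if "j \<in> {2..?n}" for j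
  proof -
    have j: "j \<in> {1..?n}" "c j = real ?n"
      using that by (auto simp: c_def)
    have "\<nu> j \<ge> 0 \<longleftrightarrow> 1 - 2 * \<beta> * (real ?n - lam j) \<ge> 0"
      using pos[OF j(1)] by (simp add: \<nu>_def j(2) zero_le_divide_iff)
    also have "\<dots> \<longleftrightarrow> inverse (ereal \<beta>) \<ge> ereal (2 * (real ?n - lam j))"
    \<comment> \<open>For \<open>\<beta> = 0\<close> the extended inverse is infinite and both sides
      hold; otherwise divide by \<open>\<beta>\<close>.\<close>
    proof (cases "\<beta> = 0")
      case False
      with \<open>\<beta> \<ge> 0\<close> show ?thesis
        by (simp add: field_simps)
    qed simp
    finally show ?thesis
      using informed[OF j(1)] by simp
  qed
  ultimately show ?thesis by blast
qed

end
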